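(* Let $(b_k)_{k\ge 0}$ be a strictly decreasing sequence of real numbers with $b_0=1$ and $\lim_{k\to\infty}b_k=0$. For $k\in\mathbb{N}$ let $g_k:[0,1]\to[b_k,b_{k-1}]$ be the affine decreasing bijection, let $S_n=\{g_1,\dots,g_n\}$, let $J_n$ be the limit set of $S_n$ and let $h_n$ be the Hausdorff dimension of $J_n$. Assume that (1) $\lim_{n\to\infty}(1-h_n)\ln n=0$, and (2) $\sup_{k\in\mathbb{N}}\left\{\frac{b_k-b_{k+1}}{b_{k+1}}\right\}<\infty$. Then $$\lim_{n\to\infty}H_{h_n}(J_n)=1 .$$
   Context: $\mathbb{N}=\{1,2,\dots\}$. The map $g_k$ is the inverse of the affine decreasing map $f_k:[b_k,b_{k-1}]\to[0,1]$ with $f_k(b_k)=1$, $f_k(b_{k-1})=0$; so $g_k(0)=b_{k-1}$, $g_k(1)=b_k$. The limit set is $J_n=\bigcap_{l=1}^{\infty}\bigcup_{(q_1,\dots,q_l)\in\{1,\dots,n\}^l} g_{q_1}\circ\cdots\circ g_{q_l}([0,1])$. $H_h$ denotes $h$-dimensional Hausdorff measure, $H_h(A)=\lim_{\delta\to0}\inf\{\sum_i \operatorname{diam}(U_i)^h: A\subset\bigcup_i U_i,\ \operatorname{diam}(U_i)\le\delta\}$ (so $H_1$ is Lebesgue measure on $\mathbb{R}$). *)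

theory Defs
  imports "HOL-Analysis.Analysis"
begin

text \<open>
  The summand \<open>diam(U)^h\<close>. For \<open>h = 0\<close> the usual convention (counting measure) is used, which
  \<^const>\<open>powr\<close> does not provide for one-point sets: a nonempty set contributes \<open>1\<close> and the
  empty set contributes \<open>0\<close>.
\<close>

definition diam_pow :: "real \<Rightarrow> 'a::metric_space set \<Rightarrow> ennreal" where
  "diam_pow h U = (if U = {} then 0 else if h = 0 then 1 else ennreal (diameter U powr h))"

text \<open>
  Finite covers are included, since the sets may be empty. Boundedness is required because
  \<^const>\<open>diameter\<close> is a real-valued supremum, hence unspecified on unbounded sets.
\<close>

definition hausdorff_premeasure :: "real \<Rightarrow> real \<Rightarrow> 'a::metric_space set \<Rightarrow> ennreal" where
  "hausdorff_premeasure h \<delta> A =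
     Inf {(\<Sum>i. diam_pow h (U i)) | U :: nat \<Rightarrow> 'a set.
            A \<subseteq> (\<Union>i. U i) \<and> (\<forall>i. bounded (U i) \<and> diameter (U i) \<le> \<delta>)}"

definition hausdorff_measure :: "real \<Rightarrow> 'a::metric_space set \<Rightarrow> ennreal" where
  "hausdorff_measure h A = Lim (at_right 0) (\<lambda>\<delta>. hausdorff_premeasure h \<delta> A)"

lemma hausdorff_premeasure_antimono:
  assumes "\<delta> \<le> \<delta>'"
  shows "hausdorff_premeasure h \<delta>' A \<le> hausdorff_premeasure h \<delta> A"
  unfolding hausdorff_premeasure_def
proof (rule Inf_superset_mono, rule subsetI, elim CollectE exE conjE)
  fix x and U :: "nat \<Rightarrow> 'a set"
  assume U: "x = (\<Sum>i. diam_pow h (U i))" "A \<subseteq> (\<Union>i. U i)"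
    "\<forall>i. bounded (U i) \<and> diameter (U i) \<le> \<delta>"
  have "\<forall>i. bounded (U i) \<and> diameter (U i) \<le> \<delta>'"
    using U(3) assms by (meson order_trans)
  with U(1,2) show "x \<in> {(\<Sum>i. diam_pow h (U i)) | U :: nat \<Rightarrow> 'a set.
      A \<subseteq> (\<Union>i. U i) \<and> (\<forall>i. bounded (U i) \<and> diameter (U i) \<le> \<delta>')}"
    by blast
qed

lemma hausdorff_premeasure_tendsto_SUP:
  "((\<lambda>\<delta>. hausdorff_premeasure h \<delta> A) \<longlongrightarrow> (SUP \<delta>\<in>{0<..}. hausdorff_premeasure h \<delta> A)) (at_right 0)"
proof (rule order_tendstoI)
  fix a assume "a < (SUP \<delta>\<in>{0<..}. hausdorff_premeasure h \<delta> A)"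
  then obtain d where d: "d > 0" "a < hausdorff_premeasure h d A"
    by (auto simp: less_SUP_iff)
  show "eventually (\<lambda>\<delta>. a < hausdorff_premeasure h \<delta> A) (at_right 0)"
    using eventually_at_right_real[OF d(1)]
  proof eventually_elim
    case (elim \<delta>)
    then have "hausdorff_premeasure h d A \<le> hausdorff_premeasure h \<delta> A"
      by (intro hausdorff_premeasure_antimono) simp
    with d(2) show ?case by (rule less_le_trans)
  qed
next
  fix a assume a: "(SUP \<delta>\<in>{0<..}. hausdorff_premeasure h \<delta> A) < a"
  show "eventually (\<lambda>\<delta>. hausdorff_premeasure h \<delta> A < a) (at_right 0)"
    using eventually_at_right_less[of "0::real"]
  proof eventually_elim
    case (elim \<delta>)
    then have "hausdorff_premeasure h \<delta> A \<le> (SUP \<delta>\<in>{0<..}. hausdorff_premeasure h \<delta> A)"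
      by (intro SUP_upper) simp
    then show ?case using a by (rule le_less_trans)
  qed
qed

lemma hausdorff_measure_eq_SUP:
  "hausdorff_measure h A = (SUP \<delta>\<in>{0<..}. hausdorff_premeasure h \<delta> A)"
  unfolding hausdorff_measure_def
  by (intro tendsto_Lim hausdorff_premeasure_tendsto_SUP) simp

text \<open>
  On subsets of a Euclidean space the infimum ranges over a nonempty set bounded below by \<open>0\<close>,
  as every \<open>h\<close> greater than the dimension of the space belongs to it.
\<close>

definition hausdorff_dim :: "'a::euclidean_space set \<Rightarrow> real" where
  "hausdorff_dim A = Inf {h. 0 \<le> h \<and> hausdorff_measure h A = 0}"

definition branch :: "(nat \<Rightarrow> real) \<Rightarrow> nat \<Rightarrow> real \<Rightarrow> real" where
  "branch b k x = b (k - 1) - (b (k - 1) - b k) * x"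

lemma branch_0 [simp]: "branch b k 0 = b (k - 1)"
  and branch_1 [simp]: "branch b k 1 = b k"
  by (simp_all add: branch_def)

lemma bij_betw_branch:
  assumes "strict_antimono_on UNIV b" "k \<ge> 1"
  shows "bij_betw (branch b k) {0..1} {b k..b (k - 1)}"
    and "strict_antimono_on {0..1} (branch b k)"
proof -
  have less: "b k < b (k - 1)"
    using assms by (auto simp: monotone_on_def)
  show "strict_antimono_on {0..1} (branch b k)"
    using less by (auto simp: monotone_on_def branch_def)
  have "branch b k ` {0..1} = {b k..b (k - 1)}"
  proof (intro equalityI subsetI)
    fix y assume "y \<in> branch b k ` {0..1}"
    then obtain x where x: "0 \<le> x" "x \<le> 1" "y = branch b k x" by auto
    have "(b (k - 1) - b k) * x \<le> (b (k - 1) - b k) * 1" "0 \<le> (b (k - 1) - b k) * x"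
      using x less by (auto intro!: mult_left_mono)
    then show "y \<in> {b k..b (k - 1)}" using x by (auto simp: branch_def)
  next
    fix y assume y: "y \<in> {b k..b (k - 1)}"
    have "y = branch b k ((b (k - 1) - y) / (b (k - 1) - b k))"
      using less by (simp add: branch_def)
    moreover have "(b (k - 1) - y) / (b (k - 1) - b k) \<in> {0..1}"
      using less y by (auto simp: divide_simps)
    ultimately show "y \<in> branch b k ` {0..1}" by blast
  qed
  then show "bij_betw (branch b k) {0..1} {b k..b (k - 1)}"
    using less by (auto simp: bij_betw_def inj_on_def branch_def)
qed

fun word_map :: "(nat \<Rightarrow> 'a \<Rightarrow> 'a) \<Rightarrow> nat list \<Rightarrow> 'a \<Rightarrow> 'a" where
  "word_map g [] = id"
| "word_map g (q # qs) = g q \<circ> word_map g qs"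

definition limit_set :: "(nat \<Rightarrow> real \<Rightarrow> real) \<Rightarrow> nat \<Rightarrow> real set" where
  "limit_set g n =
     (\<Inter>l\<in>{1..}. \<Union>qs\<in>{qs. length qs = l \<and> set qs \<subseteq> {1..n}}. word_map g qs ` {0..1})"

end

theory Submission
  imports Defs
begin

text \<open>
  Let \<open>s\<close> solve \<open>l_1^s + ... + l_n^s = 1\<close>, where \<open>l_k = b_(k-1) - b_k\<close>. Covering \<open>J_n\<close> by cylinders gives
  \<open>H_s(J_n) \<le> 1\<close>. For the lower bound let \<open>\<phi>\<close> be the distribution function of the self-similar probability
  measure, that is the fixed point of \<open>T\<close> below. It maps \<open>J_n\<close> onto \<open>[0,1]\<close>, so a Holder bound
  \<open>|\<phi> x - \<phi> y| \<le> C_n |x - y|^s\<close> gives \<open>H_s(J_n) \<ge> 1 / C_n > 0\<close>; in particular \<open>s = h_n\<close>, and it remains to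
  obtain \<open>C_n \<rightarrow> 1\<close>.

  An interval inside a single first-level cylinder can be zoomed. Any other interval consists of at most \<open>n\<close>
  pieces that end at an endpoint of their cylinder, and concavity of \<open>t^s\<close> loses only the factor
  \<open>n^(1-s)\<close> in gluing them, which tends to \<open>1\<close> by the first hypothesis. This reduces the matter to intervals
  \<open>[0,t]\<close> and \<open>[1-t,1]\<close>, whose bounds feed into each other under \<open>T\<close>. The feedback is contracting, because
  by the second hypothesis at most a proportion \<open>\<theta> < 1\<close> of \<open>[0,t]\<close> lies in its incomplete cylinder.
\<close>

section \<open>Concavity estimates for powers\<close>

lemma powr_le_tangent:
  fixes t s :: real
  assumes "0 \<le> t" "0 \<le> s" "s \<le> 1"
  shows "t powr s \<le> s * t + (1 - s)"
proof (cases "t = 0")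
  case False
  then show ?thesis
    using Youngs_inequality_0[of s "1 - s" t 1] assms by simp
qed (use assms in auto)

text \<open>The tangent line of \<open>t^s\<close> at \<open>1\<close>, applied to \<open>a i\<close> divided by the mean.\<close>

lemma sum_powr_le:
  fixes a :: "'i \<Rightarrow> real"
  assumes I: "real (card I) \<le> N" "0 < N"
    and a: "\<And>i. i \<in> I \<Longrightarrow> 0 \<le> a i"
    and s: "0 \<le> s" "s \<le> 1"
  shows "(\<Sum>i\<in>I. a i powr s) \<le> N powr (1 - s) * (\<Sum>i\<in>I. a i) powr s"
proof (cases "(\<Sum>i\<in>I. a i) = 0")
  case True
  then have "(\<Sum>i\<in>I. a i powr s) = 0"
    using a by (cases "finite I") (auto simp: sum_nonneg_eq_0_iff)
  then show ?thesis by simp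
next
  case False
  then have pos: "0 < (\<Sum>i\<in>I. a i)"
    using sum_nonneg[of I a] a by (simp add: order_less_le)
  define m where "m = (\<Sum>i\<in>I. a i) / N"
  have m: "0 < m" using pos I by (simp add: m_def)
  have "(\<Sum>i\<in>I. (a i / m) powr s) \<le> (\<Sum>i\<in>I. s * (a i / m) + (1 - s))"
    using a m s by (intro sum_mono powr_le_tangent) auto
  also have "\<dots> = s * ((\<Sum>i\<in>I. a i) / m) + (1 - s) * card I"
    by (simp add: sum.distrib sum_distrib_left sum_divide_distrib)
  also have "\<dots> \<le> s * N + (1 - s) * N"
    using pos I s by (intro add_mono mult_left_mono) (auto simp: m_def)
  finally have "(\<Sum>i\<in>I. (a i / m) powr s) \<le> N" by (simp add: algebra_simps)
  moreover have "(\<Sum>i\<in>I. (a i / m) powr s) = (\<Sum>i\<in>I. a i powr s) / m powr s"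
    using a m by (simp add: powr_divide sum_divide_distrib)
  ultimately have "(\<Sum>i\<in>I. a i powr s) \<le> N * m powr s"
    using m by (simp add: pos_divide_le_eq)
  also have "\<dots> = N powr (1 - s) * (\<Sum>i\<in>I. a i) powr s"
    using pos I by (simp add: m_def powr_divide powr_diff)
  finally show ?thesis .
qed

section \<open>Comparison tools for Hausdorff premeasures\<close>

text \<open>The finite cover is padded with empty sets, which \<open>diam_pow\<close> counts as
  \<open>0\<close> even at exponent \<open>0\<close>.\<close>

lemma hausdorff_premeasure_le_sum:
  assumes "finite I" "A \<subseteq> (\<Union>i\<in>I. U i)" "0 \<le> \<delta>"
    and "\<And>i. i \<in> I \<Longrightarrow> bounded (U i)" "\<And>i. i \<in> I \<Longrightarrow> diameter (U i) \<le> \<delta>"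
  shows "hausdorff_premeasure h \<delta> A \<le> (\<Sum>i\<in>I. diam_pow h (U i))"
proof -
  obtain f where f: "bij_betw f {0..<card I} I"
    using ex_bij_betw_nat_finite[OF assms(1)] by blast
  define V where "V i = (if i < card I then U (f i) else {})" for i
  have "A \<subseteq> (\<Union>i. V i)"
  proof
    fix x assume "x \<in> A"
    then obtain i where "i \<in> I" "x \<in> U i" using assms(2) by blast
    moreover obtain j where "j < card I" "f j = i"
      using f \<open>i \<in> I\<close> by (metis atLeastLessThan_iff bij_betw_iff_bijections)
    ultimately show "x \<in> (\<Union>i. V i)" by (auto simp: V_def)
  qed
  moreover have "bounded (V i) \<and> diameter (V i) \<le> \<delta>" for i
    using bij_betwE[OF f] assms(3-5) by (auto simp: V_def)
  ultimately have "hausdorff_premeasure h \<delta> A \<le> (\<Sum>i. diam_pow h (V i))"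
    unfolding hausdorff_premeasure_def by (intro Inf_lower) blast
  also have "\<dots> = (\<Sum>i\<in>{0..<card I}. diam_pow h (V i))"
    by (intro suminf_finite) (auto simp: V_def diam_pow_def)
  also have "\<dots> = (\<Sum>i\<in>{0..<card I}. diam_pow h (U (f i)))"
    by (intro sum.cong) (auto simp: V_def)
  also have "\<dots> = (\<Sum>i\<in>I. diam_pow h (U i))"
    using f by (rule sum.reindex_bij_betw)
  finally show ?thesis .
qed

text \<open>The last assumption excludes \<open>h = d = 0\<close>: there
  \<open>0 powr 0 = 0\<close>, whereas \<open>diam_pow\<close> of a nonempty set is
  \<open>1\<close>.\<close>

lemma diam_pow_le:
  assumes "0 \<le> h" "0 \<le> d" "diameter U \<le> d" "bounded U" "d > 0 \<or> h > 0"
  shows "diam_pow h U \<le> ennreal (d powr h)"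
  using assms diameter_ge_0[of U] by (auto simp: diam_pow_def intro!: ennreal_leI powr_mono2)

text \<open>A Holder map turns covers of \<open>A\<close> into covers of \<open>{0..1}\<close> by intervals, whose lengths add
  up to at least \<open>1\<close>; this replaces the mass distribution principle.\<close>

lemma hausdorff_premeasure_ge_Holder:
  fixes f :: "'a::metric_space \<Rightarrow> real"
  assumes "0 < C" "0 < s"
    and Holder: "\<And>x y. x \<in> A \<Longrightarrow> y \<in> A \<Longrightarrow> \<bar>f x - f y\<bar> \<le> C * dist x y powr s"
    and surj: "{0..1} \<subseteq> f ` A"
  shows "ennreal (1 / C) \<le> hausdorff_premeasure s \<delta> A"
  unfolding hausdorff_premeasure_def
proof (rule Inf_greatest, elim CollectE exE conjE)
  fix S and U :: "nat \<Rightarrow> 'a set"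
  assume S: "S = (\<Sum>i. diam_pow s (U i))" and cover: "A \<subseteq> (\<Union>i. U i)"
    and U: "\<forall>i. bounded (U i) \<and> diameter (U i) \<le> \<delta>"
  \<comment> \<open>The image itself need not be measurable, so it is enclosed in a closed interval
    whose length is the Holder bound.\<close>
  have "\<exists>V. f ` (A \<inter> U i) \<subseteq> V \<and> V \<in> sets lborel \<and> emeasure lborel V \<le> ennreal C * diam_pow s (U i)" for i
  proof (cases "A \<inter> U i = {}")
    case True
    then show ?thesis by (intro exI[of _ "{}"]) auto
  next
    case False
    define d where "d = C * diameter (U i) powr s"
    have d: "0 \<le> d" using assms by (simp add: d_def)
    have le: "f x - f y \<le> d" if "x \<in> A \<inter> U i" "y \<in> A \<inter> U i" for x y
    proof -
      have "dist x y \<le> diameter (U i)"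
        using U that by (intro diameter_bounded_bound) auto
      then have "dist x y powr s \<le> diameter (U i) powr s"
        using assms by (intro powr_mono2) auto
      then have "C * dist x y powr s \<le> d" using assms by (simp add: d_def)
      with Holder[of x y] that show ?thesis by auto
    qed
    define a where "a = Inf (f ` (A \<inter> U i))"
    obtain z where z: "z \<in> A \<inter> U i" using False by blast
    have bdd: "bdd_below (f ` (A \<inter> U i))"
      using le[of z] z by (intro bdd_belowI[of _ "f z - d"]) (auto simp: algebra_simps)
    have "f ` (A \<inter> U i) \<subseteq> {a..a + d}"
    proof safe
      fix x assume x: "x \<in> A" "x \<in> U i"
      have "a \<le> f x" unfolding a_def using x bdd by (intro cInf_lower) auto
      moreover have "f x - d \<le> a"
        unfolding a_def using x le z by (intro cInf_greatest) (auto simp: algebra_simps)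
      ultimately show "f x \<in> {a..a + d}" by auto
    qed
    moreover have "emeasure lborel {a..a + d} = ennreal C * diam_pow s (U i)"
      using d z assms by (auto simp: diam_pow_def d_def ennreal_mult)
    ultimately show ?thesis by (intro exI[of _ "{a..a + d}"]) auto
  qed
  then obtain V where V: "\<And>i. f ` (A \<inter> U i) \<subseteq> V i" "\<And>i. V i \<in> sets lborel"
    "\<And>i. emeasure lborel (V i) \<le> ennreal C * diam_pow s (U i)"
    by metis
  have "{0..1} \<subseteq> (\<Union>i. V i)"
  proof
    fix y :: real assume "y \<in> {0..1}"
    then obtain x where x: "x \<in> A" "y = f x" using surj by blast
    then obtain i where "x \<in> U i" using cover by blast
    with x V(1)[of i] show "y \<in> (\<Union>i. V i)" by blast
  qed
  then have "emeasure lborel {0..1::real} \<le> emeasure lborel (\<Union>i. V i)"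
    using V(2) by (intro emeasure_mono) auto
  also have "\<dots> \<le> (\<Sum>i. emeasure lborel (V i))"
    using V(2) by (intro emeasure_subadditive_countably) auto
  also have "\<dots> \<le> (\<Sum>i. ennreal C * diam_pow s (U i))"
    using V(3) by (intro suminf_le) auto
  also have "\<dots> = ennreal C * S" by (simp add: S)
  finally have "ennreal (1 / C) * 1 \<le> ennreal (1 / C) * (ennreal C * S)"
    by (intro mult_left_mono) auto
  then show "ennreal (1 / C) \<le> S"
    using assms by (simp flip: mult.assoc ennreal_mult)
qed

text \<open>For \<open>\<delta> \<le> 1\<close> all diameters are at most \<open>1\<close>, so
  raising the exponent cannot increase a summand. This carries positivity from the similarity
  exponent down to smaller exponents.\<close>

lemma hausdorff_premeasure_mono_dim:
  assumes "0 \<le> h" "h \<le> s" "0 < s" "\<delta> \<le> 1"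
  shows "hausdorff_premeasure s \<delta> A \<le> hausdorff_premeasure h \<delta> A"
  unfolding hausdorff_premeasure_def
proof (rule Inf_mono, elim CollectE exE conjE)
  fix S and U :: "nat \<Rightarrow> 'a set"
  assume S: "S = (\<Sum>i. diam_pow h (U i))" and U: "A \<subseteq> (\<Union>i. U i)"
    "\<forall>i. bounded (U i) \<and> diameter (U i) \<le> \<delta>"
  have "diam_pow s (U i) \<le> diam_pow h (U i)" for i
  proof -
    have "0 \<le> diameter (U i)" "diameter (U i) \<le> 1"
      using U(2) assms diameter_ge_0[of "U i"] by (auto intro: order_trans)
    then have "diameter (U i) powr s \<le> 1" "diameter (U i) powr s \<le> diameter (U i) powr h"
      using assms by (auto intro: powr_le1 powr_mono')
    then show ?thesis using assms by (auto simp: diam_pow_def intro!: ennreal_leI)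
  qed
  then have "(\<Sum>i. diam_pow s (U i)) \<le> S" unfolding S by (intro suminf_le) auto
  with U show "\<exists>a\<in>{\<Sum>i. diam_pow s (U i) |U. A \<subseteq> \<Union> (range U) \<and>
      (\<forall>i. bounded (U i) \<and> diameter (U i) \<le> \<delta>)}. a \<le> S" by blast
qed

section \<open>Geometry of the first-level cylinders\<close>

locale branch_system =
  fixes b :: "nat \<Rightarrow> real"
  assumes b_decreasing: "strict_antimono_on UNIV b"
    and b_0: "b 0 = 1"
    and b_lim: "b \<longlonglongrightarrow> 0"
begin

lemma b_less: "i < j \<Longrightarrow> b j < b i"
  using b_decreasing by (auto simp: monotone_on_def)

lemma b_le: "i \<le> j \<Longrightarrow> b j \<le> b i"
  using b_less by (cases "i = j") (auto intro: less_imp_le)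

lemma b_pos: "0 < b k"
proof -
  have "0 \<le> b (Suc k)"
    using b_lim b_le by (intro decseq_ge) (auto simp: decseq_def)
  also have "\<dots> < b k" by (rule b_less) simp
  finally show ?thesis .
qed

definition len :: "nat \<Rightarrow> real" where
  "len k = b (k - 1) - b k"

lemma len_pos: "k \<ge> 1 \<Longrightarrow> 0 < len k"
  using b_less[of "k - 1" k] by (simp add: len_def)

lemma len_nonneg: "0 \<le> len k"
  using b_le[of "k - 1" k] by (simp add: len_def)

text \<open>A contraction ratio common to all branches: the first cylinder has length
  \<open>1 - b 1\<close> and all others lie in \<open>[0, b 1]\<close>.\<close>

definition max_len :: real where
  "max_len = max (b 1) (1 - b 1)"

lemma max_len: "0 < max_len" "max_len < 1"
  using b_pos[of 1] b_less[of 0 1] by (auto simp: max_len_def b_0)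

lemma len_le_max_len: "len k \<le> max_len"
proof (cases "k \<le> 1")
  case True
  \<comment> \<open>Truncated subtraction gives \<open>len 0 = 0\<close>.\<close>
  then have "k = 0 \<or> k = 1" by auto
  then show ?thesis using b_pos[of 1] by (auto simp: len_def max_len_def b_0)
next
  case False
  then have "b (k - 1) \<le> b 1" by (intro b_le) auto
  then show ?thesis using b_pos[of k] by (simp add: len_def max_len_def)
qed

text \<open>The inverse branch, extended to be constant outside its cylinder.\<close>

definition pull :: "nat \<Rightarrow> real \<Rightarrow> real" where
  "pull k x = (b (k - 1) - max (b k) (min (b (k - 1)) x)) / len k"

lemma len_pull: "k \<ge> 1 \<Longrightarrow> len k * pull k x = b (k - 1) - max (b k) (min (b (k - 1)) x)"
  using len_pos[of k] by (simp add: pull_def)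

lemma pull_range: "k \<ge> 1 \<Longrightarrow> pull k x \<in> {0..1}"
  using len_pos[of k] b_le[of "k - 1" k] by (auto simp: pull_def len_def divide_simps)

lemma pull_above: "b (k - 1) \<le> x \<Longrightarrow> pull k x = 0"
  using b_le[of "k - 1" k] by (auto simp: pull_def)

lemma pull_below: "k \<ge> 1 \<Longrightarrow> x \<le> b k \<Longrightarrow> pull k x = 1"
  using len_pos[of k] by (auto simp: pull_def len_def min_def max_def)

lemma pull_antimono: "k \<ge> 1 \<Longrightarrow> x \<le> y \<Longrightarrow> pull k y \<le> pull k x"
  using len_pos[of k] by (auto simp: pull_def intro!: divide_right_mono)

lemma pull_branch: "k \<ge> 1 \<Longrightarrow> x \<in> {0..1} \<Longrightarrow> pull k (branch b k x) = x"
proof -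
  assume *: "k \<ge> 1" "x \<in> {0..1}"
  then have "branch b k x \<in> {b k..b (k - 1)}"
    using bij_betw_branch(1)[OF b_decreasing, of k] by (auto simp: bij_betw_def)
  then show "pull k (branch b k x) = x"
    using len_pos[of k] * by (simp add: pull_def branch_def len_def)
qed

text \<open>For \<open>x \<le> y\<close> the \<open>k\<close>-th term is the length of the part of
  \<open>[x,y]\<close> in the \<open>k\<close>-th cylinder; the cylinders tile
  \<open>[b m, 1]\<close>, so the sum telescopes.\<close>

lemma sum_len_pull_diff:
  "(\<Sum>k\<in>{1..m}. len k * (pull k x - pull k y)) = max (b m) (min 1 y) - max (b m) (min 1 x)"
proof (induction m)
  case (Suc m)
  have "b (Suc m) \<le> b m" "b m \<le> 1" using b_le[of m "Suc m"] b_le[of 0 m] by (auto simp: b_0)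
  moreover have "len (Suc m) * (pull (Suc m) x - pull (Suc m) y) =
      max (b (Suc m)) (min (b m) y) - max (b (Suc m)) (min (b m) x)"
    using len_pull[of "Suc m"] by (simp add: right_diff_distrib)
  ultimately show ?case using Suc.IH by (auto simp: max_def min_def)
qed (simp add: b_0)

lemma sum_len_upper: "q \<le> m \<Longrightarrow> (\<Sum>k\<in>{q<..m}. len k) = b q - b m"
proof (induction m)
  case (Suc m)
  show ?case
  proof (cases "q = Suc m")
    case False
    with Suc have "q \<le> m" by simp
    then have "{q<..Suc m} = insert (Suc m) {q<..m}" by auto
    with Suc.IH \<open>q \<le> m\<close> show ?thesis by (simp add: len_def)
  qed simp
qed simp

lemma sum_len_lower: "q \<ge> 1 \<Longrightarrow> (\<Sum>k\<in>{1..<q}. len k) = 1 - b (q - 1)"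
proof -
  assume "q \<ge> 1"
  then have "{1..<q} = {0<..q - 1}" by auto
  then show ?thesis using sum_len_upper[of 0 "q - 1"] by (simp add: b_0)
qed

lemma locate:
  assumes "0 < x" "x \<le> 1"
  obtains q where "q \<ge> 1" "b q < x" "x \<le> b (q - 1)"
proof -
  have "\<exists>q. b q < x"
    using order_tendstoD(2)[OF b_lim assms(1)] by (auto simp: eventually_sequentially)
  define q where "q = (LEAST q. b q < x)"
  have "b q < x" unfolding q_def using \<open>\<exists>q. b q < x\<close> by (rule LeastI_ex)
  moreover from this have "q \<ge> 1" using assms b_0 by (cases q) auto
  moreover have "\<not> b (q - 1) < x"
    using \<open>q \<ge> 1\<close> by (intro not_less_Least[of "q - 1" "\<lambda>q. b q < x", folded q_def]) auto
  ultimately show thesis using that by auto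
qed

text \<open>Intermediate value theorem: the sum is \<open>n \<ge> 2\<close> at exponent
  \<open>0\<close> and telescopes to \<open>1 - b n < 1\<close> at exponent
  \<open>1\<close>.\<close>

lemma ex_similarity_exponent:
  assumes "2 \<le> n"
  obtains s where "0 < s" "s < 1" "(\<Sum>k\<in>{1..n}. len k powr s) = 1"
proof -
  let ?S = "\<lambda>s. \<Sum>k\<in>{1..n}. len k powr s"
  have 0: "?S 0 = n" using len_pos by (simp add: less_imp_neq[symmetric])
  have "{1..n} = {0<..n}" by auto
  then have 1: "?S 1 = 1 - b n" using sum_len_upper[of 0 n] by (simp add: b_0 len_nonneg)
  have "\<exists>s\<ge>0. s \<le> 1 \<and> ?S s = 1"
    using 0 1 assms b_pos[of n] len_pos
    by (intro IVT2') (auto intro!: continuous_intros simp: less_imp_neq[symmetric])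
  then obtain s where s: "0 \<le> s" "s \<le> 1" "?S s = 1" by blast
  moreover have "s \<noteq> 0" using s(3) 0 assms by auto
  moreover have "s \<noteq> 1" using s(3) 1 b_pos[of n] by auto
  ultimately show thesis using that[of s] by auto
qed

end

section \<open>Constants of the Holder estimate\<close>

text \<open>\<open>len_le_b\<close> is the form in which the second hypothesis enters: a cylinder
  fills at most the proportion \<open>\<theta>\<close> of the interval from \<open>0\<close> to its
  right endpoint.\<close>

locale similarity_system = branch_system +
  fixes n :: nat and s \<theta> :: real
  assumes n: "2 \<le> n" and s: "0 < s" "s < 1"
    and sum_powr: "(\<Sum>k\<in>{1..n}. len k powr s) = 1"
    and \<theta>: "0 < \<theta>" "\<theta> < 1"
    and len_le_b: "\<And>k. k \<ge> 1 \<Longrightarrow> len k \<le> \<theta> * b (k - 1)"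
begin

definition D :: real where
  "D = real n powr (1 - s)"

text \<open>The constants for \<open>[0,t]\<close> and \<open>[1-t,1]\<close> are \<open>D + A'\<close> and \<open>B\<close>. The map \<open>T\<close> requires
  \<open>B \<ge> D^2 + A'\<close> and \<open>D + A' \<ge> D^2 + (B - D) \<theta>^s\<close>; \<open>A'\<close> is chosen to solve this system.\<close>

definition A' :: real where
  "A' = 2 * (D\<^sup>2 - D) / (1 - \<theta> powr s)"

definition B :: real where
  "B = D\<^sup>2 + A'"

lemma D_ge_1: "1 \<le> D"
  using n s by (simp add: D_def ge_one_powr_ge_zero)

lemma \<theta>_powr: "0 < \<theta> powr s" "\<theta> powr s < 1"
  using \<theta> s powr_less_mono2[of s \<theta> 1] by auto

lemma A'_nonneg: "0 \<le> A'"
  using D_ge_1 \<theta>_powr by (simp add: A'_def power2_eq_square)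

lemma A_le_B: "D + A' \<le> B"
  using D_ge_1 by (simp add: B_def power2_eq_square)

lemma B_ge_D: "D \<le> B"
  using A_le_B A'_nonneg by simp

text \<open>After inserting \<open>B\<close>, the claim reads \<open>(D^2 - D) * (1 + \<theta> powr
  s) \<le> (1 - \<theta> powr s) * A'\<close>, whose right side is
  \<open>2 * (D^2 - D)\<close>.\<close>

lemma A'_ineq: "D\<^sup>2 + (B - D) * \<theta> powr s \<le> D + A'"
proof -
  have "(1 - \<theta> powr s) * A' = 2 * (D\<^sup>2 - D)" using \<theta>_powr by (simp add: A'_def)
  moreover have "(D\<^sup>2 - D) * \<theta> powr s \<le> (D\<^sup>2 - D) * 1"
    using D_ge_1 \<theta>_powr by (intro mult_left_mono) (auto simp: power2_eq_square)
  ultimately show ?thesis by (simp add: B_def algebra_simps)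
qed

lemma sum_powr_le_D:
  assumes "card I \<le> n" "\<And>i. i \<in> I \<Longrightarrow> 0 \<le> a i"
  shows "(\<Sum>i\<in>I. a i powr s) \<le> D * (\<Sum>i\<in>I. a i) powr s"
  unfolding D_def using assms n s by (intro sum_powr_le) auto

lemma two_powr_le_D:
  assumes "0 \<le> x" "0 \<le> y"
  shows "x powr s + y powr s \<le> D * (x + y) powr s"
  using sum_powr_le_D[of UNIV "\<lambda>i. if i then x else y"] assms n by (simp add: UNIV_bool add.commute)

text \<open>Only the share \<open>D\<close> of the constant \<open>E\<close> is glued by concavity.
  The excess \<open>E - D\<close> stays with the second piece, so that a bound on its length can
  still shrink it.\<close>

lemma two_powr_le:
  assumes "0 \<le> x" "0 \<le> y" "D \<le> E"
  shows "D * x powr s + E * y powr s \<le> D\<^sup>2 * (x + y) powr s + (E - D) * y powr s"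
proof -
  have "D * (x powr s + y powr s) \<le> D * (D * (x + y) powr s)"
    using D_ge_1 by (intro mult_left_mono two_powr_le_D assms) auto
  then show ?thesis by (simp add: algebra_simps power2_eq_square)
qed

section \<open>The self-similarity operator and its invariant bounds\<close>

text \<open>Right side of the functional equation of the distribution function, the
  \<open>k\<close>-th cylinder having mass \<open>len k powr s\<close>. The term
  \<open>1 - f\<close> appears because the branches reverse orientation.\<close>

definition T :: "(real \<Rightarrow> real) \<Rightarrow> real \<Rightarrow> real" where
  "T f x = (\<Sum>k\<in>{1..n}. len k powr s * (1 - f (pull k x)))"

text \<open>Chosen so that \<open>T\<close> reproduces every bound with the same constant and
  pointwise limits inherit them.\<close>

definition admissible :: "(real \<Rightarrow> real) \<Rightarrow> bool" where
  "admissible f \<longleftrightarrow> f 0 = 0 \<and> f 1 = 1 \<and>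
     (\<forall>t\<in>{0..1}. 0 \<le> f t \<and> f t \<le> 1 \<and> f t \<le> (D + A') * t powr s \<and> 1 - f t \<le> B * (1 - t) powr s) \<and>
     (\<forall>x\<in>{0..1}. \<forall>y\<in>{0..1}. \<bar>f x - f y\<bar> \<le> D * B * \<bar>x - y\<bar> powr s)"

lemma T_below:
  assumes "f 1 = 1" "x \<le> b n"
  shows "T f x = 0"
  unfolding T_def
proof (intro sum.neutral ballI)
  fix k assume "k \<in> {1..n}"
  then have "pull k x = 1" using assms(2) b_le[of k n] by (intro pull_below) auto
  then show "len k powr s * (1 - f (pull k x)) = 0" using assms(1) by simp
qed

text \<open>Cylinders are numbered from right to left: those of index above \<open>q\<close> lie
  left of \<open>x\<close> and count in full, those of index below \<open>q\<close> lie to its right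
  and contribute nothing.\<close>

lemma T_cell:
  assumes f: "f 0 = 0" "f 1 = 1" and q: "1 \<le> q" "q \<le> n" "b q \<le> x" "x \<le> b (q - 1)"
  shows "T f x = len q powr s * (1 - f (pull q x)) + (\<Sum>k\<in>{q<..n}. len k powr s)"
proof -
  have "T f x = len q powr s * (1 - f (pull q x)) +
      (\<Sum>k\<in>{1..n} - {q}. len k powr s * (1 - f (pull k x)))"
    unfolding T_def using q by (intro sum.remove) auto
  also have "(\<Sum>k\<in>{1..n} - {q}. len k powr s * (1 - f (pull k x))) = (\<Sum>k\<in>{q<..n}. len k powr s)"
  proof (intro sum.mono_neutral_cong_right ballI)
    fix k assume "k \<in> {1..n} - {q} - {q<..n}"
    then have "1 \<le> k" "k \<le> q - 1" by auto
    then have "1 \<le> k" "x \<le> b k" using b_le[of k "q - 1"] q by auto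
    then have "pull k x = 1" by (rule pull_below)
    then show "len k powr s * (1 - f (pull k x)) = 0" using f by simp
  next
    fix k assume "k \<in> {q<..n}"
    then have "q \<le> k - 1" by auto
    then have "b (k - 1) \<le> x" using b_le[of q "k - 1"] q by auto
    then have "pull k x = 0" by (rule pull_above)
    then show "len k powr s * (1 - f (pull k x)) = len k powr s" using f by simp
  qed (use q in auto)
  finally show ?thesis .
qed

lemma sum_split:
  assumes "1 \<le> q" "q \<le> n"
  shows "(\<Sum>k\<in>{1..<q}. len k powr s) + len q powr s + (\<Sum>k\<in>{q<..n}. len k powr s) = 1"
proof -
  have "{1..n} = insert q ({1..<q} \<union> {q<..n})" using assms by auto
  moreover have "q \<notin> {1..<q} \<union> {q<..n}" "{1..<q} \<inter> {q<..n} = {}" by auto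
  ultimately show ?thesis using sum_powr by (simp add: sum.union_disjoint)
qed

lemma sum_powr_greater_le: "q \<le> n \<Longrightarrow> (\<Sum>k\<in>{q<..n}. len k powr s) \<le> D * b q powr s"
proof -
  assume q: "q \<le> n"
  have "(\<Sum>k\<in>{q<..n}. len k powr s) \<le> D * (\<Sum>k\<in>{q<..n}. len k) powr s"
    by (intro sum_powr_le_D) (auto simp: len_nonneg)
  also have "\<dots> \<le> D * b q powr s"
    using q b_pos[of n] b_le[of q n] s D_ge_1
    by (intro mult_left_mono powr_mono2) (auto simp: sum_len_upper)
  finally show ?thesis .
qed

lemma sum_powr_less_le: "1 \<le> q \<Longrightarrow> q \<le> n \<Longrightarrow> (\<Sum>k\<in>{1..<q}. len k powr s) \<le> D * (1 - b (q - 1)) powr s"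
  using sum_powr_le_D[of "{1..<q}" len] by (auto simp: len_nonneg sum_len_lower simp del: One_nat_def)

lemma T_0 [simp]: "f 1 = 1 \<Longrightarrow> T f 0 = 0"
  using b_pos[of n] by (intro T_below) auto

lemma T_1: "f 0 = 0 \<Longrightarrow> f 1 = 1 \<Longrightarrow> T f 1 = 1"
  using T_cell[of f 1 1] sum_split[of 1] b_le[of 0 1] n by (simp add: b_0 pull_above)

lemma T_range:
  assumes "admissible f"
  shows "0 \<le> T f x" "T f x \<le> 1"
proof -
  have *: "0 \<le> f (pull k x) \<and> f (pull k x) \<le> 1" if "1 \<le> k" for k
    using assms pull_range[OF that] unfolding admissible_def by blast
  show "0 \<le> T f x"
    unfolding T_def using * by (intro sum_nonneg mult_nonneg_nonneg) auto
  have "T f x \<le> (\<Sum>k\<in>{1..n}. len k powr s * 1)"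
    unfolding T_def using * by (intro sum_mono mult_left_mono) auto
  then show "T f x \<le> 1" using sum_powr by simp
qed

text \<open>The complete cylinders in \<open>[0,t]\<close> contribute at most
  \<open>D * b q powr s\<close>. The piece \<open>[b q, t]\<close> is pulled back, with orientation
  reversed, to an interval ending at \<open>1\<close>, where the constant \<open>B\<close>
  applies.\<close>

lemma T_le:
  assumes f: "admissible f" and t: "t \<in> {0..1}"
  shows "T f t \<le> (D + A') * t powr s"
proof (cases "t \<le> b n")
  case True
  then show ?thesis using f A'_nonneg D_ge_1 by (simp add: T_below admissible_def)
next
  case False
  with b_pos[of n] t obtain q where q: "1 \<le> q" "b q < t" "t \<le> b (q - 1)"
    using locate[of t] by auto
  have "q \<le> n" using False q(3) b_le[of n "q - 1"] by force
  have u: "pull q t \<in> {0..1}" using q by (intro pull_range)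
  have lenu: "len q * (1 - pull q t) = t - b q"
    using len_pull[of q t] q by (simp add: right_diff_distrib len_def)
  have "len q powr s * (1 - f (pull q t)) \<le> len q powr s * (B * (1 - pull q t) powr s)"
    using f u by (intro mult_left_mono) (auto simp: admissible_def)
  also have "\<dots> = B * (t - b q) powr s"
    using u by (simp add: powr_mult len_nonneg flip: lenu)
  finally have "T f t \<le> D * b q powr s + B * (t - b q) powr s"
    using T_cell[of f q t] sum_powr_greater_le[of q] q \<open>q \<le> n\<close> f by (simp add: admissible_def)
  also have "\<dots> \<le> D\<^sup>2 * (b q + (t - b q)) powr s + (B - D) * (t - b q) powr s"
    using q b_pos[of q] B_ge_D by (intro two_powr_le) auto
  also have "(B - D) * (t - b q) powr s \<le> (B - D) * (\<theta> * t) powr s"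
  proof -
    \<comment> \<open>The goal \<open>t - b q \<le> \<theta> * t\<close> rearranges to
      \<open>(1 - \<theta>) * (t - b q) \<le> \<theta> * b q\<close>; the worst case is
      \<open>t = b (q - 1)\<close>, which is \<open>len_le_b\<close>.\<close>
    have "(1 - \<theta>) * (t - b q) \<le> (1 - \<theta>) * len q"
      using \<theta> q by (intro mult_left_mono) (auto simp: len_def)
    also have "\<dots> \<le> \<theta> * b q"
      using len_le_b[OF q(1)] by (simp add: len_def algebra_simps)
    finally have "t - b q \<le> \<theta> * t" by (simp add: algebra_simps)
    then show ?thesis using q s B_ge_D by (intro mult_left_mono powr_mono2) auto
  qed
  also have "D\<^sup>2 * (b q + (t - b q)) powr s + (B - D) * (\<theta> * t) powr s =
      (D\<^sup>2 + (B - D) * \<theta> powr s) * t powr s"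
    using \<theta> t by (simp add: powr_mult algebra_simps)
  also have "\<dots> \<le> (D + A') * t powr s"
    using A'_ineq by (intro mult_right_mono) auto
  finally show ?thesis by simp
qed

text \<open>Mirror image of \<open>T_le\<close>: the incomplete piece \<open>[t, b (q - 1)]\<close>
  is pulled back to an interval starting at \<open>0\<close>, which calls for the constant
  \<open>D + A'\<close>.\<close>

lemma T_ge:
  assumes f: "admissible f" and t: "t \<in> {0..1}"
  shows "1 - T f t \<le> B * (1 - t) powr s"
proof (cases "t \<le> b n")
  case True
  have "1 = (\<Sum>k\<in>{1..n}. len k powr s)" using sum_powr by simp
  also have "\<dots> \<le> D * (1 - b n) powr s"
  proof -
    have "{1..n} = {0<..n}" by auto
    then show ?thesis
      using sum_powr_le_D[of "{1..n}" len] sum_len_upper[of 0 n] by (simp add: len_nonneg b_0)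
  qed
  also have "\<dots> \<le> B * (1 - t) powr s"
    using True b_le[of 0 n] B_ge_D D_ge_1 s by (intro mult_mono powr_mono2) (auto simp: b_0)
  finally show ?thesis using f True by (simp add: T_below admissible_def)
next
  case False
  with b_pos[of n] t obtain q where q: "1 \<le> q" "b q < t" "t \<le> b (q - 1)"
    using locate[of t] by auto
  have "q \<le> n" using False q(3) b_le[of n "q - 1"] by force
  have u: "pull q t \<in> {0..1}" using q by (intro pull_range)
  have lenu: "len q * pull q t = b (q - 1) - t"
    using len_pull[of q t] q by simp
  have "len q powr s * f (pull q t) \<le> len q powr s * ((D + A') * pull q t powr s)"
    using f u by (intro mult_left_mono) (auto simp: admissible_def)
  also have "\<dots> = (D + A') * (b (q - 1) - t) powr s"
    using u by (subst lenu[symmetric]) (simp add: powr_mult len_nonneg)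
  finally have "1 - T f t \<le> D * (1 - b (q - 1)) powr s + (D + A') * (b (q - 1) - t) powr s"
    using T_cell[of f q t] sum_powr_less_le[of q] sum_split[of q] q \<open>q \<le> n\<close> f
    by (simp add: admissible_def right_diff_distrib)
  also have "\<dots> \<le> D\<^sup>2 * ((1 - b (q - 1)) + (b (q - 1) - t)) powr s + (D + A' - D) * (b (q - 1) - t) powr s"
    using q b_le[of 0 "q - 1"] A'_nonneg by (intro two_powr_le) (auto simp: b_0)
  also have "\<dots> = D\<^sup>2 * (1 - t) powr s + A' * (b (q - 1) - t) powr s" by simp
  \<comment> \<open>No contraction is gained here: the excess \<open>A'\<close> passes to the whole
    of \<open>[t,1]\<close>, whence \<open>B = D^2 + A'\<close>.\<close>
  also have "\<dots> \<le> D\<^sup>2 * (1 - t) powr s + A' * (1 - t) powr s"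
    using q b_le[of 0 "q - 1"] A'_nonneg s
    by (intro add_left_mono mult_left_mono powr_mono2) (auto simp: b_0)
  also have "\<dots> = B * (1 - t) powr s" by (simp add: B_def algebra_simps)
  finally show ?thesis .
qed

text \<open>Inside one cylinder, scaling preserves the constant \<open>D * B\<close>. Otherwise the
  one-sided bounds give \<open>B\<close> on each cylinder and adding the pieces costs the factor
  \<open>D\<close>.\<close>

lemma T_Holder_less:
  assumes f: "admissible f" and xy: "x \<in> {0..1}" "y \<in> {0..1}" "x < y"
  shows "\<bar>T f x - T f y\<bar> \<le> D * B * (y - x) powr s"
proof (cases "\<exists>q\<in>{1..n}. b q < x \<and> y < b (q - 1)")
  case True
  then obtain q where q: "1 \<le> q" "q \<le> n" "b q < x" "y < b (q - 1)" by auto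
  have u: "pull q x \<in> {0..1}" "pull q y \<in> {0..1}" using q by (auto intro: pull_range simp del: atLeastAtMost_iff)
  have lenu: "len q * \<bar>pull q y - pull q x\<bar> = y - x"
  proof -
    have "len q * (pull q x - pull q y) = y - x"
      using len_pull[of q x] len_pull[of q y] q xy by (simp add: right_diff_distrib)
    moreover have "pull q y \<le> pull q x" using q xy by (intro pull_antimono) auto
    ultimately show ?thesis by (simp add: abs_of_nonpos)
  qed
  have "T f x - T f y = len q powr s * (f (pull q y) - f (pull q x))"
    using T_cell[of f q x] T_cell[of f q y] q xy f by (simp add: admissible_def algebra_simps)
  then have "\<bar>T f x - T f y\<bar> = len q powr s * \<bar>f (pull q y) - f (pull q x)\<bar>"
    by (simp add: abs_mult)
  also have "\<dots> \<le> len q powr s * (D * B * \<bar>pull q y - pull q x\<bar> powr s)"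
    using f u by (intro mult_left_mono) (auto simp: admissible_def)
  also have "\<dots> = D * B * (y - x) powr s"
    by (simp add: powr_mult len_nonneg flip: lenu)
  finally show ?thesis .
next
  case False
  have "\<bar>T f x - T f y\<bar> = \<bar>\<Sum>k\<in>{1..n}. len k powr s * (f (pull k y) - f (pull k x))\<bar>"
    by (simp add: T_def algebra_simps flip: sum_subtractf)
  also have "\<dots> \<le> (\<Sum>k\<in>{1..n}. len k powr s * \<bar>f (pull k y) - f (pull k x)\<bar>)"
    by (rule order_trans[OF sum_abs]) (simp add: abs_mult)
  also have "\<dots> \<le> (\<Sum>k\<in>{1..n}. B * (len k * (pull k x - pull k y)) powr s)"
  proof (intro sum_mono)
    fix k assume k: "k \<in> {1..n}"
    have u: "pull k x \<in> {0..1}" "pull k y \<in> {0..1}" using k pull_range[of k] by auto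
    have le: "pull k y \<le> pull k x" using k xy by (intro pull_antimono) auto
    from False k have "\<not> (b k < x \<and> y < b (k - 1))" by blast
    \<comment> \<open>The pulled-back interval reaches \<open>1\<close> or \<open>0\<close>; it
      degenerates to a point if \<open>[x,y]\<close> misses the cylinder.\<close>
    then have "x \<le> b k \<or> b (k - 1) \<le> y" by linarith
    then have "pull k x = 1 \<or> pull k y = 0" using k pull_below pull_above by auto
    then have "\<bar>f (pull k y) - f (pull k x)\<bar> \<le> B * (pull k x - pull k y) powr s"
    proof
      assume "pull k x = 1"
      moreover have "f (pull k y) \<le> 1" "1 - f (pull k y) \<le> B * (1 - pull k y) powr s" "f 1 = 1"
        using f u unfolding admissible_def by blast+
      ultimately show ?thesis by simp
    next
      assume "pull k y = 0"
      moreover have "(D + A') * pull k x powr s \<le> B * pull k x powr s"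
        using A_le_B by (intro mult_right_mono) auto
      moreover have "0 \<le> f (pull k x)" "f (pull k x) \<le> (D + A') * pull k x powr s" "f 0 = 0"
        using f u unfolding admissible_def by blast+
      ultimately show ?thesis by simp
    qed
    then have "len k powr s * \<bar>f (pull k y) - f (pull k x)\<bar> \<le> len k powr s * (B * (pull k x - pull k y) powr s)"
      by (intro mult_left_mono) auto
    also have "\<dots> = B * (len k * (pull k x - pull k y)) powr s"
      using le by (simp add: powr_mult len_nonneg)
    finally show "len k powr s * \<bar>f (pull k y) - f (pull k x)\<bar> \<le> \<dots>" .
  qed
  also have "\<dots> = B * (\<Sum>k\<in>{1..n}. (len k * (pull k x - pull k y)) powr s)"
    by (simp add: sum_distrib_left)
  also have "\<dots> \<le> B * (D * (\<Sum>k\<in>{1..n}. len k * (pull k x - pull k y)) powr s)"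
    using xy B_ge_D D_ge_1
    by (intro mult_left_mono sum_powr_le_D mult_nonneg_nonneg) (auto simp: len_nonneg pull_antimono)
  also have "\<dots> = D * B * (max (b n) (min 1 y) - max (b n) (min 1 x)) powr s"
    by (simp only: sum_len_pull_diff) simp
  also have "\<dots> \<le> D * B * (y - x) powr s"
    using xy s B_ge_D D_ge_1 by (intro mult_left_mono powr_mono2) auto
  finally show ?thesis .
qed

lemma admissible_T: "admissible f \<Longrightarrow> admissible (T f)"
proof -
  assume f: "admissible f"
  have "\<bar>T f x - T f y\<bar> \<le> D * B * \<bar>x - y\<bar> powr s" if "x \<in> {0..1}" "y \<in> {0..1}" for x y
    using T_Holder_less[OF f, of x y] T_Holder_less[OF f, of y x] that
    by (cases x y rule: linorder_cases) (auto simp: abs_minus_commute)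
  moreover have "f 0 = 0" "f 1 = 1" using f by (auto simp: admissible_def)
  ultimately show ?thesis
    using T_range[OF f] T_le[OF f] T_ge[OF f] T_1 unfolding admissible_def by simp
qed

text \<open>On \<open>[0,1]\<close> one has \<open>t \<le> t powr s\<close>, and all constants are
  at least \<open>1\<close>. The identity starts the iteration.\<close>

lemma admissible_id: "admissible (\<lambda>x. x)"
proof -
  have le: "t \<le> E * t powr s" if "t \<in> {0..1}" "1 \<le> E" for t E
  proof -
    have "t powr 1 \<le> 1 * t powr s" using s that powr_mono'[of s 1 t] by simp
    also have "\<dots> \<le> E * t powr s" using that by (intro mult_right_mono) auto
    finally show ?thesis using that by simp
  qed
  have "1 \<le> D + A'" "1 \<le> B" using D_ge_1 A'_nonneg B_ge_D by auto
  moreover from this have "1 * 1 \<le> D * B" using D_ge_1 by (intro mult_mono) auto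
  ultimately show ?thesis unfolding admissible_def by (auto intro!: le)
qed

section \<open>The distribution function as a fixed point\<close>

text \<open>Admissible functions agree at \<open>0\<close> and \<open>1\<close>, so
  \<open>T f x\<close> and \<open>T g x\<close> differ only in the term of the cylinder containing
  \<open>x\<close>.\<close>

lemma T_contraction:
  assumes f: "admissible f" and g: "admissible g" and x: "x \<in> {0..1}"
    and c: "\<And>t. t \<in> {0..1} \<Longrightarrow> \<bar>f t - g t\<bar> \<le> c"
  shows "\<bar>T f x - T g x\<bar> \<le> max_len powr s * c"
proof (cases "x \<le> b n")
  case True
  have "0 \<le> c" using c[of 0] by simp
  with True f g show ?thesis by (simp add: T_below admissible_def)
next
  case False
  with b_pos[of n] x obtain q where q: "1 \<le> q" "b q < x" "x \<le> b (q - 1)"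
    using locate[of x] by auto
  have "q \<le> n" using False q(3) b_le[of n "q - 1"] by force
  have "T f x - T g x = len q powr s * (g (pull q x) - f (pull q x))"
    using T_cell[of f q x] T_cell[of g q x] q \<open>q \<le> n\<close> f g
    by (simp add: admissible_def algebra_simps)
  then have "\<bar>T f x - T g x\<bar> = len q powr s * \<bar>f (pull q x) - g (pull q x)\<bar>"
    by (simp add: abs_mult abs_minus_commute)
  also have "\<dots> \<le> max_len powr s * c"
    using s c[OF pull_range[OF q(1)]] len_le_max_len[of q]
    by (intro mult_mono powr_mono2) (auto simp: len_nonneg)
  finally show ?thesis .
qed

definition approx :: "nat \<Rightarrow> real \<Rightarrow> real" where
  "approx j = (T ^^ j) (\<lambda>x. x)"

lemma approx_Suc: "approx (Suc j) = T (approx j)"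
  by (simp add: approx_def)

lemma admissible_approx: "admissible (approx j)"
  by (induction j) (simp_all add: approx_def admissible_id admissible_T)

lemma approx_diff:
  "x \<in> {0..1} \<Longrightarrow> \<bar>approx (Suc j) x - approx j x\<bar> \<le> (max_len powr s) ^ j"
proof (induction j arbitrary: x)
  case 0
  have "approx (Suc 0) x \<in> {0..1}" "approx 0 x \<in> {0..1}"
    using admissible_approx[of "Suc 0"] admissible_approx[of 0] 0 unfolding admissible_def by auto
  then show ?case by (simp add: abs_le_iff)
next
  case (Suc j)
  then show ?case
    using T_contraction[OF admissible_approx[of "Suc j"] admissible_approx[of j]] by (simp add: approx_Suc)
qed

text \<open>This is the function \<open>\<phi>\<close>. Convergence, which gives \<open>lim\<close>
  its meaning, is shown on \<open>[0,1]\<close>.\<close>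

definition cantor :: "real \<Rightarrow> real" where
  "cantor x = lim (\<lambda>j. approx j x)"

lemma approx_LIMSEQ:
  assumes "x \<in> {0..1}"
  shows "(\<lambda>j. approx j x) \<longlonglongrightarrow> cantor x"
proof -
  have "max_len powr s < 1"
    using max_len s powr_less_mono2[of s max_len 1] by simp
  then have "summable (\<lambda>j. (max_len powr s) ^ j)" by (intro summable_geometric) simp
  then have "summable (\<lambda>j. approx (Suc j) x - approx j x)"
    by (rule summable_comparison_test'[where N = 0]) (use approx_diff[OF assms] in simp)
  then have "convergent (\<lambda>j. \<Sum>i<j. approx (Suc i) x - approx i x)"
    by (simp add: summable_iff_convergent)
  then have "convergent (\<lambda>j. (approx j x - approx 0 x) + approx 0 x)"
    unfolding sum_lessThan_telescope[of "\<lambda>j. approx j x"] by (intro convergent_add convergent_const)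
  then show ?thesis unfolding cantor_def by (simp add: convergent_LIMSEQ_iff)
qed

lemma cantor_Holder:
  assumes "x \<in> {0..1}" "y \<in> {0..1}"
  shows "\<bar>cantor x - cantor y\<bar> \<le> D * B * \<bar>x - y\<bar> powr s"
proof (rule LIMSEQ_le_const2)
  show "(\<lambda>j. \<bar>approx j x - approx j y\<bar>) \<longlonglongrightarrow> \<bar>cantor x - cantor y\<bar>"
    using assms by (intro tendsto_intros approx_LIMSEQ)
  show "\<exists>N. \<forall>j\<ge>N. \<bar>approx j x - approx j y\<bar> \<le> D * B * \<bar>x - y\<bar> powr s"
    using admissible_approx assms unfolding admissible_def by blast
qed

lemma cantor_0: "cantor 0 = 0" and cantor_1: "cantor 1 = 1"
  using admissible_approx LIMSEQ_unique[OF approx_LIMSEQ] by (simp_all add: admissible_def)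

lemma T_cantor:
  assumes "x \<in> {0..1}"
  shows "T cantor x = cantor x"
proof (rule LIMSEQ_unique)
  show "(\<lambda>j. approx (Suc j) x) \<longlonglongrightarrow> cantor x"
    using approx_LIMSEQ[OF assms] by (rule LIMSEQ_Suc)
  show "(\<lambda>j. approx (Suc j) x) \<longlonglongrightarrow> T cantor x"
    unfolding approx_Suc T_def by (intro tendsto_intros approx_LIMSEQ pull_range) auto
qed

lemma continuous_on_cantor: "continuous_on {0..1} cantor"
  unfolding continuous_on_def
proof
  fix x :: real assume x: "x \<in> {0..1}"
  have "((\<lambda>y. D * B * \<bar>y - x\<bar> powr s) \<longlongrightarrow> D * B * \<bar>x - x\<bar> powr s) (at x within {0..1})"
    using s by (intro tendsto_intros) auto
  then have "((\<lambda>y. D * B * \<bar>y - x\<bar> powr s) \<longlongrightarrow> 0) (at x within {0..1})" by simp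
  then have "((\<lambda>y. cantor y - cantor x) \<longlongrightarrow> 0) (at x within {0..1})"
    by (rule Lim_null_comparison[rotated])
       (use cantor_Holder x in \<open>auto simp: eventually_at_topological\<close>)
  then show "(cantor \<longlongrightarrow> cantor x) (at x within {0..1})" by (simp add: LIM_zero_iff)
qed

section \<open>Nested levels and surjectivity on the limit set\<close>

text \<open>Unlike in \<open>limit_set\<close>, the index may be \<open>0\<close>, which gives
  inductions the base \<open>level 0 = {0..1}\<close>.\<close>

definition level :: "nat \<Rightarrow> real set" where
  "level l = (\<Union>qs\<in>{qs. length qs = l \<and> set qs \<subseteq> {1..n}}. word_map (branch b) qs ` {0..1})"

lemma limit_set_eq: "limit_set (branch b) n = (\<Inter>l\<in>{1..}. level l)"
  by (simp add: limit_set_def level_def)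

lemma level_0: "level 0 = {0..1}"
  by (auto simp: level_def)

lemma level_Suc: "level (Suc l) = (\<Union>k\<in>{1..n}. branch b k ` level l)"
proof (intro set_eqI iffI)
  fix y assume "y \<in> level (Suc l)"
  then obtain k qs t where "length qs = l" "set (k # qs) \<subseteq> {1..n}" "t \<in> {0..1}"
    "y = word_map (branch b) (k # qs) t"
    unfolding level_def by (fastforce simp: length_Suc_conv)
  moreover from this have "word_map (branch b) qs t \<in> level l" by (auto simp: level_def)
  ultimately show "y \<in> (\<Union>k\<in>{1..n}. branch b k ` level l)" by auto
next
  fix y assume "y \<in> (\<Union>k\<in>{1..n}. branch b k ` level l)"
  then obtain k qs t where "k \<in> {1..n}" "length qs = l" "set qs \<subseteq> {1..n}" "t \<in> {0..1}"
    "y = branch b k (word_map (branch b) qs t)"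
    unfolding level_def by blast
  then have "length (k # qs) = Suc l" "set (k # qs) \<subseteq> {1..n}" "y = word_map (branch b) (k # qs) t"
    by simp_all
  then show "y \<in> level (Suc l)" using \<open>t \<in> {0..1}\<close> unfolding level_def by blast
qed

lemma branch_unit: "1 \<le> k \<Longrightarrow> x \<in> {0..1} \<Longrightarrow> branch b k x \<in> {b k..b (k - 1)}"
  using bij_betw_branch(1)[OF b_decreasing, of k] by (auto simp: bij_betw_def)

lemma branch_in_unit: "1 \<le> k \<Longrightarrow> x \<in> {0..1} \<Longrightarrow> branch b k x \<in> {0..1}"
  using branch_unit[of k x] b_pos[of k] b_le[of 0 "k - 1"] by (auto simp: b_0)

lemma level_Suc_subset: "level (Suc l) \<subseteq> level l"
proof (induction l)
  case 0
  show ?case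
  proof
    fix y assume "y \<in> level (Suc 0)"
    then obtain k x where "k \<in> {1..n}" "x \<in> {0..1}" "y = branch b k x"
      unfolding level_Suc level_0 by blast
    then show "y \<in> level 0" using branch_in_unit[of k x] by (simp add: level_0)
  qed
next
  case (Suc l)
  then show ?case by (subst (1 2) level_Suc) blast
qed

lemma level_mono: "l \<le> m \<Longrightarrow> level m \<subseteq> level l"
  using level_Suc_subset by (rule lift_Suc_antimono_le)

lemma compact_level: "compact (level l)"
proof (induction l)
  case (Suc l)
  then show ?case
    unfolding level_Suc branch_def
    by (intro compact_UN compact_continuous_image continuous_intros) auto
qed (simp add: level_0)

lemma cantor_branch:
  assumes "1 \<le> k" "k \<le> n" "x \<in> {0..1}"
  shows "cantor (branch b k x) = len k powr s * (1 - cantor x) + (\<Sum>j\<in>{k<..n}. len j powr s)"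
  using T_cell[OF cantor_0 cantor_1 assms(1,2), of "branch b k x"] branch_unit[OF assms(1,3)]
    T_cantor[OF branch_in_unit[OF assms(1,3)]] pull_branch[OF assms(1,3)] by simp

text \<open>The tail sums decrease from \<open>1\<close> at \<open>k = 0\<close> to \<open>0\<close>
  at \<open>k = n\<close>; consecutive ones bound the image of the \<open>k\<close>-th cylinder
  under \<open>cantor\<close>.\<close>

lemma locate_value:
  assumes "0 \<le> y" "y \<le> 1"
  obtains k where "1 \<le> k" "k \<le> n" "(\<Sum>j\<in>{k<..n}. len j powr s) \<le> y"
    "y \<le> len k powr s + (\<Sum>j\<in>{k<..n}. len j powr s)"
proof -
  define c where "c k = (\<Sum>j\<in>{k<..n}. len j powr s)" for k
  have c_step: "c (k - 1) = len k powr s + c k" if "1 \<le> k" "k \<le> n" for k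
  proof -
    have "{k - 1<..n} = insert k {k<..n}" using that by auto
    then show ?thesis by (simp add: c_def)
  qed
  have "{0<..n} = {1..n}" by auto
  then have c0: "c 0 = 1" using sum_powr by (simp add: c_def)
  have cn: "c n \<le> y" using assms by (simp add: c_def)
  define k where "k = (LEAST k. c k \<le> y)"
  have k: "c k \<le> y" "k \<le> n" unfolding k_def using cn by (auto intro: LeastI Least_le)
  show thesis
  proof (cases "k = 0")
    \<comment> \<open>The least index is \<open>0\<close> only for \<open>y = 1\<close>, a value
      that the first cylinder attains as well.\<close>
    case True
    with k c0 assms have "y = 1" by simp
    moreover have "len 1 powr s + c 1 = 1" using c_step[of 1] c0 n by simp
    moreover have "0 \<le> len 1 powr s" by simp
    ultimately have "c 1 \<le> y" "y \<le> len 1 powr s + c 1" by linarith+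
    then show thesis using that[of 1] n by (simp add: c_def)
  next
    case False
    then have "\<not> c (k - 1) \<le> y"
      by (intro not_less_Least[of "k - 1" "\<lambda>k. c k \<le> y", folded k_def]) auto
    with False k c_step[of k] show thesis using that[of k] by (simp add: c_def)
  qed
qed

lemma level_subset_unit: "level l \<subseteq> {0..1}"
  using level_mono[of 0 l] by (simp add: level_0)

lemma cantor_level: "{0..1} \<subseteq> cantor ` level l"
proof (induction l)
  case 0
  show ?case
  proof
    fix y :: real assume "y \<in> {0..1}"
    then have "\<exists>x\<ge>0. x \<le> 1 \<and> cantor x = y"
      using continuous_on_cantor by (intro IVT') (auto simp: cantor_0 cantor_1)
    then show "y \<in> cantor ` level 0" by (auto simp: level_0)
  qed
next
  case (Suc l)
  show ?case
  proof
    fix y :: real assume "y \<in> {0..1}"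
    then obtain k where k: "1 \<le> k" "k \<le> n" "(\<Sum>j\<in>{k<..n}. len j powr s) \<le> y"
        "y \<le> len k powr s + (\<Sum>j\<in>{k<..n}. len j powr s)"
      using locate_value[of y] by auto
    define z where "z = 1 - (y - (\<Sum>j\<in>{k<..n}. len j powr s)) / len k powr s"
    have p: "0 < len k powr s" using len_pos[OF k(1)] by simp
    then have "z \<in> {0..1}" using k by (auto simp: z_def)
    then obtain x where x: "x \<in> level l" "cantor x = z" using Suc by blast
    have "cantor (branch b k x) = len k powr s * (1 - z) + (\<Sum>j\<in>{k<..n}. len j powr s)"
      using cantor_branch[OF k(1,2)] x level_subset_unit[of l] by blast
    also have "\<dots> = y" using p by (simp add: z_def)
    finally show "y \<in> cantor ` level (Suc l)" using x k by (force simp: level_Suc)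
  qed
qed

text \<open>A value is attained on every level, but possibly at different points. Its fibres in the
  levels are nested nonempty compact sets, so one point serves all.\<close>

lemma cantor_limit_set: "{0..1} \<subseteq> cantor ` limit_set (branch b) n"
proof
  fix y :: real assume y: "y \<in> {0..1}"
  define F where "F l = level l \<inter> cantor -` {y}" for l
  have "closed (level l \<inter> cantor -` {y})" for l
    using continuous_on_subset[OF continuous_on_cantor level_subset_unit] compact_level[of l]
    by (intro continuous_closed_preimage compact_imp_closed) auto
  then have "compact (F l)" for l
    using compact_Int_closed[OF compact_level[of l], of "F l"] by (simp add: F_def Int_assoc[symmetric])
  moreover have "F l \<noteq> {}" for l using cantor_level[of l] y unfolding F_def by blast
  moreover have "F m \<subseteq> F l" if "l \<le> m" for l m using level_mono[OF that] by (auto simp: F_def)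
  ultimately have "\<Inter> (range F) \<noteq> {}" by (rule compact_nest)
  then obtain x where "\<And>l. x \<in> F l" by auto
  then show "y \<in> cantor ` limit_set (branch b) n" by (force simp: F_def limit_set_eq)
qed

lemma limit_set_subset_unit: "limit_set (branch b) n \<subseteq> {0..1}"
  using level_subset_unit by (force simp: limit_set_eq)

section \<open>Hausdorff measure and dimension of the limit set\<close>

lemma premeasure_ge: "ennreal (1 / (D * B)) \<le> hausdorff_premeasure s \<delta> (limit_set (branch b) n)"
proof (rule hausdorff_premeasure_ge_Holder)
  show "0 < D * B" using D_ge_1 B_ge_D by simp
  show "{0..1} \<subseteq> cantor ` limit_set (branch b) n" by (rule cantor_limit_set)
  show "\<bar>cantor x - cantor y\<bar> \<le> D * B * dist x y powr s"
    if "x \<in> limit_set (branch b) n" "y \<in> limit_set (branch b) n" for x y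
    unfolding dist_real_def using that limit_set_subset_unit by (intro cantor_Holder) auto
qed (use s in auto)

lemma measure_ge: "ennreal (1 / (D * B)) \<le> hausdorff_measure s (limit_set (branch b) n)"
  unfolding hausdorff_measure_eq_SUP using premeasure_ge[of 1] by (intro SUP_upper2[of 1]) auto

lemma dist_word_map:
  "dist (word_map (branch b) qs x) (word_map (branch b) qs y) = prod_list (map len qs) * dist x y"
proof (induction qs)
  case (Cons q qs)
  have "dist (branch b q u) (branch b q v) = len q * dist u v" for u v
  proof -
    have "branch b q u - branch b q v = len q * (v - u)" by (simp add: branch_def len_def algebra_simps)
    then show ?thesis by (simp add: dist_real_def abs_mult len_nonneg abs_minus_commute)
  qed
  with Cons show ?case by simp
qed simp

lemma sum_prod_list:
  "(\<Sum>qs\<in>{qs. set qs \<subseteq> {1..n} \<and> length qs = l}. prod_list (map len qs) powr h) =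
    (\<Sum>k\<in>{1..n}. len k powr h) ^ l"
proof (induction l)
  case 0
  have "{qs. set qs \<subseteq> {1..n} \<and> length qs = 0} = {[]}" by auto
  then show ?case by simp
next
  case (Suc l)
  have inj: "inj_on (\<lambda>(xs, n). n # xs) A" for A :: "(nat list \<times> nat) set" by (auto simp: inj_on_def)
  have nn: "0 \<le> prod_list (map len qs)" for qs by (induction qs) (auto simp: len_nonneg)
  let ?W = "{qs. set qs \<subseteq> {1..n} \<and> length qs = l}"
  have "(\<Sum>qs\<in>{qs. set qs \<subseteq> {1..n} \<and> length qs = Suc l}. prod_list (map len qs) powr h) =
      (\<Sum>(qs, k)\<in>?W \<times> {1..n}. prod_list (map len qs) powr h * len k powr h)"
    unfolding lists_length_Suc_eq sum.reindex[OF inj]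
    by (simp add: case_prod_unfold powr_mult len_nonneg nn mult.commute)
  also have "\<dots> = (\<Sum>qs\<in>?W. prod_list (map len qs) powr h) * (\<Sum>k\<in>{1..n}. len k powr h)"
    by (simp add: sum_product sum.cartesian_product)
  finally show ?case unfolding Suc.IH by (simp add: mult.commute)
qed

text \<open>The cylinders of level \<open>l\<close> serve as the cover. At \<open>h = s\<close> the
  bound is \<open>1\<close>; for \<open>h > s\<close> it tends to \<open>0\<close> as
  \<open>l\<close> grows.\<close>

lemma premeasure_le:
  assumes "0 < h" "max_len ^ l \<le> \<delta>" "1 \<le> l"
  shows "hausdorff_premeasure h \<delta> (limit_set (branch b) n) \<le> ennreal ((\<Sum>k\<in>{1..n}. len k powr h) ^ l)"
proof -
  let ?W = "{qs. set qs \<subseteq> {1..n} \<and> length qs = l}"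
  let ?U = "\<lambda>qs. word_map (branch b) qs ` {0..1}"
  have nn: "0 \<le> prod_list (map len qs)" for qs by (induction qs) (auto simp: len_nonneg)
  have le: "prod_list (map len qs) \<le> max_len ^ length qs" for qs
    using max_len len_le_max_len nn by (induction qs) (auto intro!: mult_mono simp: len_nonneg)
  have dist_le: "dist x y \<le> prod_list (map len qs)" if "x \<in> ?U qs" "y \<in> ?U qs" for x y qs
  proof -
    obtain u v where uv: "u \<in> {0..1}" "v \<in> {0..1}" "x = word_map (branch b) qs u" "y = word_map (branch b) qs v"
      using \<open>x \<in> ?U qs\<close> \<open>y \<in> ?U qs\<close> by blast
    then have "prod_list (map len qs) * dist u v \<le> prod_list (map len qs) * 1"
      by (intro mult_left_mono nn) (auto simp: dist_real_def)
    then show ?thesis by (simp add: uv dist_word_map)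
  qed
  then have diam: "diameter (?U qs) \<le> prod_list (map len qs)" for qs
    by (intro diameter_le) (auto simp: dist_norm)
  have bdd: "bounded (?U qs)" for qs
    using dist_le unfolding bounded_def by (metis all_not_in_conv)
  have "finite ?W" by (intro finite_lists_length_eq) simp
  have "hausdorff_premeasure h \<delta> (limit_set (branch b) n) \<le> (\<Sum>qs\<in>?W. diam_pow h (?U qs))"
  proof (rule hausdorff_premeasure_le_sum[OF \<open>finite ?W\<close>])
    show "limit_set (branch b) n \<subseteq> (\<Union>qs\<in>?W. ?U qs)"
    proof -
      have "limit_set (branch b) n \<subseteq> level l" using assms(3) by (auto simp: limit_set_eq)
      then show ?thesis unfolding level_def by blast
    qed
    show "0 \<le> \<delta>" using assms(2) max_len zero_le_power[of max_len l] by linarith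
    show "diameter (?U qs) \<le> \<delta>" if "qs \<in> ?W" for qs
    proof -
      have "length qs = l" using that by simp
      then show ?thesis
        using order_trans[OF diam[of qs] le[of qs]] assms(2) by (metis order_trans)
    qed
  qed (rule bdd)
  also have "\<dots> \<le> (\<Sum>qs\<in>?W. ennreal (prod_list (map len qs) powr h))"
    using assms(1) by (intro sum_mono diam_pow_le diam bdd nn) auto
  also have "\<dots> = ennreal ((\<Sum>k\<in>{1..n}. len k powr h) ^ l)"
    using sum_prod_list[where l = l and h = h] by (subst sum_ennreal) auto
  finally show ?thesis .
qed

lemma ex_level: "0 < \<delta> \<Longrightarrow> \<exists>N\<ge>1. \<forall>l\<ge>N. max_len ^ l \<le> \<delta>"
proof -
  assume "0 < \<delta>"
  moreover have "(\<lambda>l. max_len ^ l) \<longlonglongrightarrow> 0" using max_len by (intro LIMSEQ_realpow_zero) auto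
  ultimately have "eventually (\<lambda>l. max_len ^ l < \<delta>) sequentially" by (rule order_tendstoD(2)[rotated])
  then obtain N where "\<forall>l\<ge>N. max_len ^ l < \<delta>" by (auto simp: eventually_sequentially)
  then show ?thesis by (intro exI[of _ "Suc N"]) (auto intro: less_imp_le)
qed

lemma measure_le: "hausdorff_measure s (limit_set (branch b) n) \<le> 1"
  unfolding hausdorff_measure_eq_SUP
proof (rule SUP_least)
  fix \<delta> :: real assume "\<delta> \<in> {0<..}"
  then obtain l where "1 \<le> l" "max_len ^ l \<le> \<delta>" using ex_level[of \<delta>] by auto
  then show "hausdorff_premeasure s \<delta> (limit_set (branch b) n) \<le> 1"
    using premeasure_le[of s l \<delta>] s sum_powr by simp
qed

text \<open>All \<open>len k\<close> are below \<open>1\<close>, so the sum of powers drops strictly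
  below \<open>1\<close> past \<open>s\<close>, and the bounds by its powers tend to
  \<open>0\<close>.\<close>

lemma measure_eq_0:
  assumes "s < h"
  shows "hausdorff_measure h (limit_set (branch b) n) = 0"
proof -
  define S where "S = (\<Sum>k\<in>{1..n}. len k powr h)"
  have len1: "len k < 1" for k using len_le_max_len[of k] max_len by simp
  have "S < (\<Sum>k\<in>{1..n}. len k powr s)"
    unfolding S_def using n assms len_pos len1 by (intro sum_strict_mono powr_less_mono') auto
  then have S: "0 \<le> S" "S < 1" using sum_powr by (auto simp: S_def intro: sum_nonneg)
  have "hausdorff_premeasure h \<delta> (limit_set (branch b) n) \<le> 0" if \<delta>: "0 < \<delta>" for \<delta>
  proof (rule LIMSEQ_le_const)
    have "(\<lambda>l. S ^ l) \<longlonglongrightarrow> 0" using S by (intro LIMSEQ_realpow_zero) auto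
    then show "(\<lambda>l. ennreal (S ^ l)) \<longlonglongrightarrow> 0" using tendsto_ennrealI by fastforce
    obtain N where "1 \<le> N" "\<forall>l\<ge>N. max_len ^ l \<le> \<delta>" using ex_level[OF \<delta>] by blast
    then show "\<exists>N. \<forall>l\<ge>N. hausdorff_premeasure h \<delta> (limit_set (branch b) n) \<le> ennreal (S ^ l)"
      using premeasure_le[of h _ \<delta>] s assms unfolding S_def by (intro exI[of _ N]) auto
  qed
  then show ?thesis unfolding hausdorff_measure_eq_SUP by (auto simp: bot_ennreal)
qed

lemma hausdorff_dim_eq: "hausdorff_dim (limit_set (branch b) n) = s"
proof -
  \<comment> \<open>Positivity is read off at the single scale \<open>\<delta> = 1\<close>, where
    lowering the exponent from \<open>s\<close> cannot decrease the premeasure.\<close>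
  have "hausdorff_measure h (limit_set (branch b) n) \<noteq> 0" if "0 \<le> h" "h \<le> s" for h
  proof -
    have "0 < ennreal (1 / (D * B))" using D_ge_1 B_ge_D by simp
    also have "\<dots> \<le> hausdorff_premeasure s 1 (limit_set (branch b) n)" by (rule premeasure_ge)
    also have "\<dots> \<le> hausdorff_premeasure h 1 (limit_set (branch b) n)"
      using that s by (intro hausdorff_premeasure_mono_dim) auto
    also have "\<dots> \<le> hausdorff_measure h (limit_set (branch b) n)"
      unfolding hausdorff_measure_eq_SUP by (intro SUP_upper) auto
    finally show ?thesis by simp
  qed
  then have "{h. 0 \<le> h \<and> hausdorff_measure h (limit_set (branch b) n) = 0} = {s<..}"
    using measure_eq_0 s by force
  then show ?thesis by (simp add: hausdorff_dim_def)
qed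

end

section \<open>Passage to the limit\<close>

theorem theorem4p8:
  fixes b :: "nat \<Rightarrow> real"
    and J :: "nat \<Rightarrow> real set"
    and h :: "nat \<Rightarrow> real"
  assumes b_decreasing: "strict_antimono_on UNIV b"
    and b_0: "b 0 = 1"
    and b_lim: "b \<longlonglongrightarrow> 0"
    and J_def: "\<And>n. J n = limit_set (branch b) n"
    and h_def: "\<And>n. h n = hausdorff_dim (J n)"
    and dim_lim: "(\<lambda>n. (1 - h n) * ln (real n)) \<longlonglongrightarrow> 0"
    and ratio_bdd: "bdd_above ((\<lambda>k. (b k - b (k + 1)) / b (k + 1)) ` {1..})"
  shows "(\<lambda>n. hausdorff_measure (h n) (J n)) \<longlonglongrightarrow> 1"
proof -
  interpret branch_system b by unfold_locales fact+
  obtain M0 where M0: "\<And>k. 1 \<le> k \<Longrightarrow> (b k - b (k + 1)) / b (k + 1) \<le> M0"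
    using ratio_bdd by (force simp: bdd_above_def)
  \<comment> \<open>\<open>M0\<close> bounds the ratios from \<open>k = 1\<close> on; the maximum
    adds the ratio of the first cylinder, \<open>(b 0 - b 1) / b 1\<close>.\<close>
  define M where "M = max M0 ((1 - b 1) / b 1)"
  have "0 < (1 - b 1) / b 1" using b_pos[of 1] b_less[of 0 1] by (simp add: b_0)
  then have M: "0 < M" by (auto simp: M_def)
  have ratio: "b (k - 1) - b k \<le> M * b k" if "1 \<le> k" for k
  proof -
    have "(b (k - 1) - b k) / b k \<le> M"
    proof (cases "k = 1")
      case False
      with that have "(b (k - 1) - b k) / b k \<le> M0" using M0[of "k - 1"] by simp
      then show ?thesis by (simp add: M_def)
    qed (simp add: M_def b_0)
    then show ?thesis using b_pos[of k] by (simp add: pos_divide_le_eq)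
  qed
  \<comment> \<open>From \<open>len k \<le> M * b k\<close> and
    \<open>b k = b (k - 1) - len k\<close> follows
    \<open>len k \<le> M / (1 + M) * b (k - 1)\<close>, uniformly in \<open>n\<close>.\<close>
  define \<theta> where "\<theta> = M / (1 + M)"
  have \<theta>: "0 < \<theta>" "\<theta> < 1" using M by (auto simp: \<theta>_def)
  have len_le: "len k \<le> \<theta> * b (k - 1)" if "1 \<le> k" for k
    using ratio[OF that] M by (simp add: \<theta>_def len_def field_simps)
  define D where "D n = real n powr (1 - h n)" for n
  \<comment> \<open>For \<open>n \<ge> 2\<close> this is \<open>D * B\<close> of
    \<open>similarity_system\<close> at \<open>s = h n\<close>, restated outside the locale since
    \<open>s\<close> varies with \<open>n\<close>.\<close>
  define C where "C n = D n * ((D n)\<^sup>2 + 2 * ((D n)\<^sup>2 - D n) / (1 - \<theta> powr h n))" for n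
  have bounds: "ennreal (1 / C n) \<le> hausdorff_measure (h n) (J n) \<and> hausdorff_measure (h n) (J n) \<le> 1"
    if n: "2 \<le> n" for n
  proof -
    obtain s where s: "0 < s" "s < 1" "(\<Sum>k\<in>{1..n}. len k powr s) = 1"
      using ex_similarity_exponent[OF n] .
    interpret S: similarity_system b n s \<theta>
      by unfold_locales (use n s \<theta> len_le in auto)
    have "h n = s" by (simp add: h_def J_def S.hausdorff_dim_eq)
    then show ?thesis
      using S.measure_ge S.measure_le by (simp add: J_def C_def D_def S.D_def S.B_def S.A'_def)
  qed
  have ln_pos: "eventually (\<lambda>n. 0 < ln (real n)) sequentially"
    using eventually_gt_at_top[of 1] by eventually_elim simp
  \<comment> \<open>As \<open>ln n\<close> tends to infinity, the first hypothesis forces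
    \<open>h n\<close> to \<open>1\<close>.\<close>
  have "(\<lambda>n. inverse (ln (real n))) \<longlonglongrightarrow> 0"
    by (intro tendsto_inverse_0_at_top filterlim_compose[OF ln_at_top filterlim_real_sequentially])
  then have "(\<lambda>n. 1 - ((1 - h n) * ln (real n)) * inverse (ln (real n))) \<longlonglongrightarrow> 1 - 0 * 0"
    using dim_lim by (intro tendsto_intros)
  moreover have "eventually (\<lambda>n. 1 - ((1 - h n) * ln (real n)) * inverse (ln (real n)) = h n) sequentially"
    using ln_pos by eventually_elim (simp add: mult.assoc)
  ultimately have h_lim: "h \<longlonglongrightarrow> 1"
    using Lim_transform_eventually by fastforce
  have "(\<lambda>n. exp ((1 - h n) * ln (real n))) \<longlonglongrightarrow> exp 0"
    using dim_lim by (intro tendsto_intros)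
  moreover have "eventually (\<lambda>n. exp ((1 - h n) * ln (real n)) = D n) sequentially"
    using eventually_gt_at_top[of 0] by eventually_elim (simp add: D_def powr_def)
  ultimately have D_lim: "D \<longlonglongrightarrow> 1"
    using Lim_transform_eventually by fastforce
  \<comment> \<open>The excess vanishes: \<open>D^2 - D\<close> tends to \<open>0\<close> while its
    denominator tends to \<open>1 - \<theta> > 0\<close>.\<close>
  have "C \<longlonglongrightarrow> 1 * (1\<^sup>2 + 2 * (1\<^sup>2 - 1) / (1 - \<theta> powr 1))"
    unfolding C_def using \<theta> by (intro tendsto_intros D_lim h_lim) auto
  then have C_lim: "C \<longlonglongrightarrow> 1" by simp
  have "(\<lambda>n. ennreal (1 / C n)) \<longlonglongrightarrow> ennreal (1 / 1)"
    by (intro tendsto_ennrealI tendsto_intros C_lim) auto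
  then have lower: "(\<lambda>n. ennreal (1 / C n)) \<longlonglongrightarrow> 1" by simp
  show ?thesis
  proof (rule tendsto_sandwich[OF _ _ lower tendsto_const])
    show "eventually (\<lambda>n. ennreal (1 / C n) \<le> hausdorff_measure (h n) (J n)) sequentially"
      using eventually_ge_at_top[of 2] by eventually_elim (use bounds in blast)
    show "eventually (\<lambda>n. hausdorff_measure (h n) (J n) \<le> 1) sequentially"
      using eventually_ge_at_top[of 2] by eventually_elim (use bounds in blast)
  qed
qed

end
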